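(* Let $(X,d)$ be a metric space with at least two points and let $\mathcal{B}$ be a bornology on $X$ with a closed base. Then $\chi(C(X),\tau_{\mathcal{B}}^{w}) = dn_{\mathcal{B}}(X)\cdot w_{X}(\mathcal{B})$.
   Context: A bornology on $X$ is a family $\mathcal{B}$ of nonempty subsets of $X$ that covers $X$ and is an ideal, i.e. is closed under finite unions and under passing to nonempty subsets. A base for $\mathcal{B}$ is a subfamily $\mathcal{B}_0\subseteq\mathcal{B}$ such that every $B\in\mathcal{B}$ is contained in some $B'\in\mathcal{B}_0$; $\mathcal{B}$ has a closed base if it has a base all of whose members are closed in $(X,d)$. The weight of $\mathcal{B}$ is $w_X(\mathcal{B})=\aleph_0+\min\{|\mathcal{B}_0| : \mathcal{B}_0 \text{ is a base for } \mathcal{B}\}$. $C(X)$ is the set of continuous functions $X\to\mathbb{R}$, and $C^+(X)$ the set of continuous functions $X\to(0,\infty)$. The topology $\tau_{\mathcal{B}}^{w}$ of Whitney convergence on $\mathcal{B}$ is the topology on $C(X)$ induced by the uniformity having as a base the sets $[B,\epsilon]^{w}=\{(f,g): |f(x)-g(x)|<\epsilon(x)\ \forall x\in B\}$ with $B\in\mathcal{B}$, $\epsilon\in C^+(X)$. A set $F\subseteq C(X)$ is dominating with respect to $\mathcal{B}$ if for every $f\in C(X)$ and every $B\in\mathcal{B}$ there exists $g\in F$ with $f(x)\le g(x)$ for all $x\in B$. The domination number is $dn_{\mathcal{B}}(X)=\aleph_0+\min\{|F|: F\subseteq C(X)\text{ is dominating with respect to }\mathcal{B}\}$. For a topological space $Y$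 and $y\in Y$, $\chi(Y,y)=\aleph_0+\min\{|\mathscr{B}_y|:\mathscr{B}_y\text{ is a local base of }Y\text{ at }y\}$, and the character of $Y$ is $\chi(Y)=\sup\{\chi(Y,y):y\in Y\}$. *)

theory Defs
  imports "HOL-Analysis.Analysis"
begin

unbundle cardinal_syntax

section \<open>Cardinals\<close>

text \<open>
  Cardinals are the cardinal orders of the library, compared up to \<open>=o\<close>; \<open>natLeq\<close> is
  \<open>\<aleph>\<^sub>0\<close>. In \<open>min_card\<close> a set of least cardinality is chosen from the family; see
  \<open>min_card_attained\<close> and \<open>min_card_le\<close>.
\<close>

definition min_card :: "'b set set \<Rightarrow> 'b rel" where
  "min_card F = |SOME A. A \<in> F \<and> (\<forall>A'\<in>F. |A| \<le>o |A'| )|"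

text \<open>
  The supremum of a set of cardinals on one type is the least cardinal that bounds all of them.
  The carrier type contains an upper bound, so restricting the candidates to sets over this
  type loses nothing: by \<open>card_sup_least\<close> the result lies below upper bounds over any type.
\<close>

definition card_sup :: "'b rel set \<Rightarrow> 'b rel" where
  "card_sup R = min_card {A. \<forall>r\<in>R. r \<le>o |A|}"

lemma min_card_aux:
  assumes "F \<noteq> {}"
  shows "\<exists>A. A \<in> F \<and> (\<forall>A'\<in>F. |A| \<le>o |A'| )"
  using exists_minim_Card_order[of "card_of ` F"] assms by (auto simp: card_of_Card_order)

lemma min_card_attained:
  assumes "F \<noteq> {}"
  shows "\<exists>A\<in>F. min_card F = |A|"
  unfolding min_card_def using someI_ex[OF min_card_aux[OF assms]] by blast

lemma min_card_le:
  assumes "A \<in> F"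
  shows "min_card F \<le>o |A|"
proof -
  have "F \<noteq> {}" using assms by blast
  from someI_ex[OF min_card_aux[OF this]] show ?thesis
    unfolding min_card_def using assms by blast
qed

lemma card_sup_candidates:
  fixes R :: "'b rel set"
  assumes "\<forall>r\<in>R. Card_order r"
  shows "(UNIV :: 'b set) \<in> {A. \<forall>r\<in>R. r \<le>o |A|}"
proof -
  have "r \<le>o |UNIV :: 'b set|" if "r \<in> R" for r
    using assms that card_of_Field_ordIso[of r] card_of_mono1[of "Field r" UNIV]
    by (meson ordIso_ordLeq_trans ordIso_symmetric subset_UNIV)
  then show ?thesis by blast
qed

lemma card_sup_upper:
  assumes "\<forall>r\<in>R. Card_order r" and "r \<in> R"
  shows "r \<le>o card_sup R"
  using min_card_attained[of "{A. \<forall>r\<in>R. r \<le>o |A|}"] card_sup_candidates[OF assms(1)] assms(2)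
  unfolding card_sup_def by fastforce

lemma card_sup_least:
  fixes R :: "'b rel set" and T :: "'c set"
  assumes "\<forall>r\<in>R. Card_order r" and T: "\<forall>r\<in>R. r \<le>o |T|"
  shows "card_sup R \<le>o |T|"
proof (cases "|UNIV :: 'b set| \<le>o |T|")
  case True
  have "card_sup R \<le>o |UNIV :: 'b set|"
    unfolding card_sup_def by (rule min_card_le) (rule card_sup_candidates[OF assms(1)])
  then show ?thesis using True by (rule ordLeq_transitive)
next
  case False
  then have "|T| \<le>o |UNIV :: 'b set|"
    using ordLeq_total[OF card_of_Well_order card_of_Well_order, of T "UNIV :: 'b set"] by blast
  then obtain h :: "'c \<Rightarrow> 'b" where h: "inj_on h T"
    using card_of_ordLeq[of T "UNIV :: 'b set"] by blast
  have eq: "|T| =o |h ` T|"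
    using h card_of_ordIso[of T "h ` T"] by (auto intro: inj_on_imp_bij_betw)
  have "\<forall>r\<in>R. r \<le>o |h ` T|" using T eq ordLeq_ordIso_trans by blast
  then have "card_sup R \<le>o |h ` T|" unfolding card_sup_def by (intro min_card_le) blast
  then show ?thesis using eq ordIso_symmetric ordLeq_ordIso_trans by blast
qed

section \<open>Bornologies\<close>

definition bornology :: "'a set set \<Rightarrow> bool" where
  "bornology \<B> \<longleftrightarrow>
     {} \<notin> \<B> \<and> \<Union>\<B> = UNIV \<and>
     (\<forall>A\<in>\<B>. \<forall>B\<in>\<B>. A \<union> B \<in> \<B>) \<and>
     (\<forall>B\<in>\<B>. \<forall>A. A \<subseteq> B \<and> A \<noteq> {} \<longrightarrow> A \<in> \<B>)"

definition bornology_base :: "'a set set \<Rightarrow> 'a set set \<Rightarrow> bool" where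
  "bornology_base \<B> \<B>\<^sub>0 \<longleftrightarrow> \<B>\<^sub>0 \<subseteq> \<B> \<and> (\<forall>B\<in>\<B>. \<exists>B'\<in>\<B>\<^sub>0. B \<subseteq> B')"

definition has_closed_base :: "'a::topological_space set set \<Rightarrow> bool" where
  "has_closed_base \<B> \<longleftrightarrow> (\<exists>\<B>\<^sub>0. bornology_base \<B> \<B>\<^sub>0 \<and> (\<forall>B\<in>\<B>\<^sub>0. closed B))"

definition bornology_weight :: "'a set set \<Rightarrow> (nat + 'a set) rel" where
  "bornology_weight \<B> = natLeq +c min_card {\<B>\<^sub>0. bornology_base \<B> \<B>\<^sub>0}"

section \<open>Continuous functions and the Whitney topology\<close>

definition cont_funs :: "('a::topological_space \<Rightarrow> real) set" where
  "cont_funs = {f. continuous_on UNIV f}"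

definition pos_cont_funs :: "('a::topological_space \<Rightarrow> real) set" where
  "pos_cont_funs = {f. continuous_on UNIV f \<and> (\<forall>x. f x > 0)}"

definition whitney_basic ::
    "'a set \<Rightarrow> ('a \<Rightarrow> real) \<Rightarrow> (('a::topological_space \<Rightarrow> real) \<times> ('a \<Rightarrow> real)) set" where
  "whitney_basic B \<epsilon> = {(f, g). f \<in> cont_funs \<and> g \<in> cont_funs \<and> (\<forall>x\<in>B. \<bar>f x - g x\<bar> < \<epsilon> x)}"

definition whitney_uniformity ::
    "'a set set \<Rightarrow> (('a::topological_space \<Rightarrow> real) \<times> ('a \<Rightarrow> real)) set set" where
  "whitney_uniformity \<B> =
     {E. E \<subseteq> cont_funs \<times> cont_funs \<and> (\<exists>B\<in>\<B>. \<exists>\<epsilon>\<in>pos_cont_funs. whitney_basic B \<epsilon> \<subseteq> E)}"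

definition whitney_topology :: "'a set set \<Rightarrow> ('a::topological_space \<Rightarrow> real) topology" where
  "whitney_topology \<B> =
     topology (\<lambda>U. U \<subseteq> cont_funs \<and> (\<forall>f\<in>U. \<exists>E\<in>whitney_uniformity \<B>. E `` {f} \<subseteq> U))"

lemma whitney_uniformity_Int:
  assumes "bornology \<B>" and "E \<in> whitney_uniformity \<B>" and "E' \<in> whitney_uniformity \<B>"
  shows "E \<inter> E' \<in> whitney_uniformity \<B>"
proof -
  obtain B \<epsilon> where 1: "B \<in> \<B>" "\<epsilon> \<in> pos_cont_funs" "whitney_basic B \<epsilon> \<subseteq> E"
    using assms(2) unfolding whitney_uniformity_def by blast
  obtain B' \<epsilon>' where 2: "B' \<in> \<B>" "\<epsilon>' \<in> pos_cont_funs" "whitney_basic B' \<epsilon>' \<subseteq> E'"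
    using assms(3) unfolding whitney_uniformity_def by blast
  have "B \<union> B' \<in> \<B>" using assms(1) 1(1) 2(1) unfolding bornology_def by blast
  moreover have "(\<lambda>x. min (\<epsilon> x) (\<epsilon>' x)) \<in> pos_cont_funs"
    using 1(2) 2(2) unfolding pos_cont_funs_def by (auto intro: continuous_intros)
  moreover have "whitney_basic (B \<union> B') (\<lambda>x. min (\<epsilon> x) (\<epsilon>' x)) \<subseteq> whitney_basic B \<epsilon>"
    and "whitney_basic (B \<union> B') (\<lambda>x. min (\<epsilon> x) (\<epsilon>' x)) \<subseteq> whitney_basic B' \<epsilon>'"
    unfolding whitney_basic_def by auto
  ultimately show ?thesis
    using assms(2) 1(3) 2(3) unfolding whitney_uniformity_def by blast
qed

lemma openin_whitney_topology:
  assumes "bornology \<B>"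
  shows "openin (whitney_topology \<B>) U \<longleftrightarrow>
    U \<subseteq> cont_funs \<and> (\<forall>f\<in>U. \<exists>E\<in>whitney_uniformity \<B>. E `` {f} \<subseteq> U)"
proof -
  have "istopology (\<lambda>U. U \<subseteq> cont_funs \<and> (\<forall>f\<in>U. \<exists>E\<in>whitney_uniformity \<B>. E `` {f} \<subseteq> U))"
    unfolding istopology_def
  proof (intro conjI allI impI)
    fix S T :: "('a \<Rightarrow> real) set"
    assume S: "S \<subseteq> cont_funs \<and> (\<forall>f\<in>S. \<exists>E\<in>whitney_uniformity \<B>. E `` {f} \<subseteq> S)"
      and T: "T \<subseteq> cont_funs \<and> (\<forall>f\<in>T. \<exists>E\<in>whitney_uniformity \<B>. E `` {f} \<subseteq> T)"
    show "S \<inter> T \<subseteq> cont_funs" using S by blast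
    show "\<forall>f\<in>S \<inter> T. \<exists>E\<in>whitney_uniformity \<B>. E `` {f} \<subseteq> S \<inter> T"
    proof
      fix f assume "f \<in> S \<inter> T"
      then obtain E E' where "E \<in> whitney_uniformity \<B>" "E `` {f} \<subseteq> S"
        "E' \<in> whitney_uniformity \<B>" "E' `` {f} \<subseteq> T" using S T by blast
      then show "\<exists>E\<in>whitney_uniformity \<B>. E `` {f} \<subseteq> S \<inter> T"
        using whitney_uniformity_Int[OF assms, of E E'] by blast
    qed
  next
    fix K :: "('a \<Rightarrow> real) set set"
    assume K: "\<forall>S\<in>K. S \<subseteq> cont_funs \<and> (\<forall>f\<in>S. \<exists>E\<in>whitney_uniformity \<B>. E `` {f} \<subseteq> S)"
    show "\<Union>K \<subseteq> cont_funs" using K by blast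
    show "\<forall>f\<in>\<Union>K. \<exists>E\<in>whitney_uniformity \<B>. E `` {f} \<subseteq> \<Union>K"
    proof
      fix f assume "f \<in> \<Union>K"
      then obtain S where S: "S \<in> K" "f \<in> S" by blast
      then obtain E where "E \<in> whitney_uniformity \<B>" "E `` {f} \<subseteq> S" using K by blast
      then show "\<exists>E\<in>whitney_uniformity \<B>. E `` {f} \<subseteq> \<Union>K" using S(1) by blast
    qed
  qed
  then show ?thesis unfolding whitney_topology_def by simp
qed

lemma topspace_whitney_topology:
  fixes \<B> :: "'a::topological_space set set"
  assumes "bornology \<B>"
  shows "topspace (whitney_topology \<B>) = cont_funs"
proof
  show "topspace (whitney_topology \<B>) \<subseteq> cont_funs"
    using openin_whitney_topology[OF assms, of "topspace (whitney_topology \<B>)"] by simp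
  have "undefined \<in> \<Union>\<B>" using assms unfolding bornology_def by simp
  then obtain B where "B \<in> \<B>" by blast
  moreover have "(\<lambda>_. 1) \<in> (pos_cont_funs :: ('a \<Rightarrow> real) set)"
    unfolding pos_cont_funs_def by simp
  moreover have "whitney_basic B (\<lambda>_. 1) \<subseteq> cont_funs \<times> cont_funs"
    unfolding whitney_basic_def by auto
  ultimately have E: "cont_funs \<times> cont_funs \<in> whitney_uniformity \<B>"
    unfolding whitney_uniformity_def by blast
  have "(cont_funs \<times> cont_funs) `` {f} \<subseteq> cont_funs" for f :: "'a \<Rightarrow> real"
    by auto
  then have "openin (whitney_topology \<B>) cont_funs"
    unfolding openin_whitney_topology[OF assms] using E by auto
  then show "cont_funs \<subseteq> topspace (whitney_topology \<B>)" by (rule openin_subset)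
qed

definition dominating :: "'a::topological_space set set \<Rightarrow> ('a \<Rightarrow> real) set \<Rightarrow> bool" where
  "dominating \<B> F \<longleftrightarrow>
     F \<subseteq> cont_funs \<and> (\<forall>f\<in>cont_funs. \<forall>B\<in>\<B>. \<exists>g\<in>F. \<forall>x\<in>B. f x \<le> g x)"

definition domination_number :: "'a::topological_space set set \<Rightarrow> (nat + ('a \<Rightarrow> real)) rel" where
  "domination_number \<B> = natLeq +c min_card {F. dominating \<B> F}"

section \<open>Character of a topological space\<close>

definition local_base :: "'b topology \<Rightarrow> 'b \<Rightarrow> 'b set set \<Rightarrow> bool" where
  "local_base Y y \<V> \<longleftrightarrow>
     (\<forall>V\<in>\<V>. openin Y V \<and> y \<in> V) \<and> (\<forall>U. openin Y U \<and> y \<in> U \<longrightarrow> (\<exists>V\<in>\<V>. V \<subseteq> U))"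

definition character_at :: "'b topology \<Rightarrow> 'b \<Rightarrow> (nat + 'b set) rel" where
  "character_at Y y = natLeq +c min_card {\<V>. local_base Y y \<V>}"

definition character :: "'b topology \<Rightarrow> (nat + 'b set) rel" where
  "character Y = card_sup (character_at Y ` topspace Y)"

end

theory Submission
  imports Defs
begin

text \<open>
  A basic neighbourhood of \<open>f\<close> is determined by a set \<open>B\<close> of the bornology and a positive
  continuous function \<open>\<epsilon>\<close>. Enlarging \<open>B\<close> and shrinking \<open>\<epsilon>\<close> shrinks the neighbourhood, and
  shrinking \<open>\<epsilon>\<close> is the same as letting \<open>1 / \<epsilon>\<close> grow. So the neighbourhood filter at \<open>f\<close> should
  have the same cofinality as the product of two directed sets: the bornology under inclusion
  and the continuous functions under domination on its members.

  One direction is \<open>local_base_from_dominating\<close>: if the sets \<open>B\<close> run through a base and the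
  functions \<open>g\<close> through a dominating family, open sets chosen inside the
  neighbourhoods given by \<open>B\<close> and \<open>1 / max g 1\<close> form a local base.

  Conversely, both \<open>B\<close> and \<open>\<epsilon>\<close> can be recovered from the neighbourhood, up to a factor 2
  (\<open>whitney_basic_Image_subsetD\<close>), provided that the smaller neighbourhood is given by a closed
  set. This is where the closed base enters: every neighbourhood contains a basic one over a
  closed set, because the bornology is then stable under closure. Choosing such a basic
  neighbourhood inside each member of a local base yields a base of the bornology
  (\<open>weight_le_local_base\<close>) and a dominating family (\<open>domination_le_local_base\<close>), each indexed
  by the local base.

  Since all three cardinals are infinite, products and sums of them are maxima, and the two
  estimates combine to the equality. The estimates hold at every \<open>f\<close>, so the supremum over the
  points is harmless.
\<close>

section \<open>Neighbourhoods in the Whitney topology\<close>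

lemma whitney_basic_iff:
  "(f, g) \<in> whitney_basic B \<epsilon> \<longleftrightarrow>
     f \<in> cont_funs \<and> g \<in> cont_funs \<and> (\<forall>x\<in>B. \<bar>f x - g x\<bar> < \<epsilon> x)"
  by (simp add: whitney_basic_def)

lemma whitney_basic_in_uniformity:
  assumes "B \<in> \<B>" and "\<epsilon> \<in> pos_cont_funs"
  shows "whitney_basic B \<epsilon> \<in> whitney_uniformity \<B>"
  using assms unfolding whitney_uniformity_def by (auto simp: whitney_basic_def)

lemma whitney_open_contains_basic:
  assumes "bornology \<B>" and "openin (whitney_topology \<B>) U" and "f \<in> U"
  shows "\<exists>B\<in>\<B>. \<exists>\<epsilon>\<in>pos_cont_funs. whitney_basic B \<epsilon> `` {f} \<subseteq> U"
proof -
  obtain E where E: "E \<in> whitney_uniformity \<B>" "E `` {f} \<subseteq> U"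
    using assms openin_whitney_topology by blast
  then obtain B \<epsilon> where "B \<in> \<B>" "\<epsilon> \<in> pos_cont_funs" "whitney_basic B \<epsilon> \<subseteq> E"
    unfolding whitney_uniformity_def by blast
  then show ?thesis using E(2) by blast
qed

text \<open>
  The set of all functions having some basic neighbourhood inside the given one is open by
  halving the radius, as in any uniform space.
\<close>
lemma whitney_basic_contains_open:
  assumes "bornology \<B>" and "B \<in> \<B>" and "\<epsilon> \<in> pos_cont_funs" and "f \<in> cont_funs"
  shows "\<exists>U. openin (whitney_topology \<B>) U \<and> f \<in> U \<and> U \<subseteq> whitney_basic B \<epsilon> `` {f}"
proof -
  define N where "N = whitney_basic B \<epsilon> `` {f}"
  define U where
    "U = {g \<in> cont_funs. \<exists>B\<in>\<B>. \<exists>\<delta>\<in>pos_cont_funs. whitney_basic B \<delta> `` {g} \<subseteq> N}"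
  have "\<exists>E\<in>whitney_uniformity \<B>. E `` {g} \<subseteq> U" if g: "g \<in> U" for g
  proof -
    obtain C \<delta> where C: "C \<in> \<B>" "\<delta> \<in> pos_cont_funs" "whitney_basic C \<delta> `` {g} \<subseteq> N"
      using g unfolding U_def by blast
    define \<eta> where "\<eta> = (\<lambda>x. \<delta> x / 2)"
    have \<eta>: "\<eta> \<in> pos_cont_funs"
      using C(2) unfolding pos_cont_funs_def \<eta>_def by (auto intro!: continuous_intros)
    have "whitney_basic C \<eta> `` {h} \<subseteq> whitney_basic C \<delta> `` {g}"
      if h: "h \<in> whitney_basic C \<eta> `` {g}" for h
    proof
      fix k assume k: "k \<in> whitney_basic C \<eta> `` {h}"
      have "\<bar>g x - k x\<bar> < \<delta> x" if "x \<in> C" for x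
      proof -
        have "\<bar>g x - h x\<bar> < \<delta> x / 2" "\<bar>h x - k x\<bar> < \<delta> x / 2"
          using h k that by (auto simp: whitney_basic_iff \<eta>_def)
        then show ?thesis by linarith
      qed
      then show "k \<in> whitney_basic C \<delta> `` {g}"
        using h k by (auto simp: whitney_basic_iff)
    qed
    then have N: "whitney_basic C \<eta> `` {h} \<subseteq> N" if "h \<in> whitney_basic C \<eta> `` {g}" for h
      using C(3) that by (meson subset_trans)
    have "whitney_basic C \<eta> `` {g} \<subseteq> U"
    proof
      fix h assume h: "h \<in> whitney_basic C \<eta> `` {g}"
      then have "h \<in> cont_funs" by (simp add: whitney_basic_iff)
      then show "h \<in> U" unfolding U_def using C(1) \<eta> N[OF h] by blast
    qed
    then show ?thesis using whitney_basic_in_uniformity[OF C(1) \<eta>] by blast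
  qed
  then have "openin (whitney_topology \<B>) U"
    unfolding openin_whitney_topology[OF assms(1)] U_def by blast
  moreover have "f \<in> U" using assms unfolding U_def N_def by blast
  moreover have "U \<subseteq> N"
  proof
    fix g assume "g \<in> U"
    then obtain C \<delta> where "g \<in> cont_funs" "\<delta> \<in> pos_cont_funs" "whitney_basic C \<delta> `` {g} \<subseteq> N"
      unfolding U_def by blast
    moreover from this have "g \<in> whitney_basic C \<delta> `` {g}"
      by (simp add: whitney_basic_iff pos_cont_funs_def)
    ultimately show "g \<in> N" by blast
  qed
  ultimately show ?thesis unfolding N_def by blast
qed

text \<open>
  The neighbourhood over \<open>B'\<close> of radius \<open>\<epsilon>'\<close> contains \<open>f + \<epsilon>' / 2\<close>, which bounds \<open>\<epsilon>'\<close> on \<open>B\<close>.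
  It imposes nothing off \<open>B'\<close>: the distance to \<open>B'\<close>, suitably scaled and added to \<open>f\<close>, remains in
  the neighbourhood but can be made large at any given point outside \<open>B'\<close>, as \<open>B'\<close> is closed.
\<close>
lemma whitney_basic_Image_subsetD:
  fixes f :: "'a::metric_space \<Rightarrow> real"
  assumes f: "f \<in> cont_funs" and \<epsilon>': "\<epsilon>' \<in> pos_cont_funs"
    and B': "closed B'" "B' \<noteq> {}"
    and sub: "whitney_basic B' \<epsilon>' `` {f} \<subseteq> whitney_basic B \<epsilon> `` {f}"
  shows "B \<subseteq> B'" and "\<forall>x\<in>B. \<epsilon>' x < 2 * \<epsilon> x"
proof -
  have pos: "0 < \<epsilon>' x" for x using \<epsilon>' by (simp add: pos_cont_funs_def)
  have test: "\<bar>h x\<bar> < \<epsilon> x"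
    if "continuous_on UNIV h" and "\<forall>y\<in>B'. \<bar>h y\<bar> < \<epsilon>' y" and "x \<in> B" for h x
  proof -
    have "(\<lambda>y. f y + h y) \<in> cont_funs"
      using f that(1) unfolding cont_funs_def by (auto intro: continuous_intros)
    then have "(\<lambda>y. f y + h y) \<in> whitney_basic B' \<epsilon>' `` {f}"
      using f that(2) by (simp add: whitney_basic_iff)
    then have "(\<lambda>y. f y + h y) \<in> whitney_basic B \<epsilon> `` {f}" using sub by blast
    then show ?thesis using that(3) by (simp add: whitney_basic_iff)
  qed
  show "\<forall>x\<in>B. \<epsilon>' x < 2 * \<epsilon> x"
  proof
    fix x assume "x \<in> B"
    moreover have "continuous_on UNIV (\<lambda>y. \<epsilon>' y / 2)"
      using \<epsilon>' unfolding pos_cont_funs_def by (auto intro!: continuous_intros)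
    moreover have "\<bar>\<epsilon>' y / 2\<bar> < \<epsilon>' y" for y using pos[of y] by linarith
    ultimately have "\<bar>\<epsilon>' x / 2\<bar> < \<epsilon> x" using test[of "\<lambda>y. \<epsilon>' y / 2" x] by blast
    then show "\<epsilon>' x < 2 * \<epsilon> x" by linarith
  qed
  show "B \<subseteq> B'"
  proof (rule ccontr)
    assume "\<not> B \<subseteq> B'"
    then obtain x where x: "x \<in> B" "x \<notin> B'" by blast
    have d: "infdist x B' \<noteq> 0" using B' x(2) in_closed_iff_infdist_zero by blast
    define h where "h = (\<lambda>y. infdist y B' * (\<epsilon> x / infdist x B'))"
    have "continuous_on UNIV h"
      unfolding h_def by (intro continuous_intros)
    moreover have "\<forall>y\<in>B'. \<bar>h y\<bar> < \<epsilon>' y" using pos by (simp add: h_def)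
    ultimately have "\<bar>h x\<bar> < \<epsilon> x" using test x(1) by blast
    then show False using d by (simp add: h_def)
  qed
qed

section \<open>Closed sets in the bornology\<close>

lemma bornology_closed_superset:
  assumes "has_closed_base \<B>" and "B \<in> \<B>"
  shows "\<exists>C\<in>\<B>. closed C \<and> B \<subseteq> C"
  using assms unfolding has_closed_base_def bornology_base_def by blast

lemma whitney_open_contains_closed_basic:
  assumes "bornology \<B>" and "has_closed_base \<B>"
    and "openin (whitney_topology \<B>) U" and "f \<in> U"
  shows "\<exists>B \<epsilon>. B \<in> \<B> \<and> closed B \<and> \<epsilon> \<in> pos_cont_funs \<and> whitney_basic B \<epsilon> `` {f} \<subseteq> U"
proof -
  obtain B \<epsilon> where B: "B \<in> \<B>" "\<epsilon> \<in> pos_cont_funs" "whitney_basic B \<epsilon> `` {f} \<subseteq> U"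
    using whitney_open_contains_basic[OF assms(1,3,4)] by blast
  obtain C where C: "C \<in> \<B>" "closed C" "B \<subseteq> C"
    using bornology_closed_superset[OF assms(2) B(1)] by blast
  have "whitney_basic C \<epsilon> `` {f} \<subseteq> whitney_basic B \<epsilon> `` {f}"
    using C(3) by (fastforce simp: whitney_basic_iff)
  then show ?thesis using B C by blast
qed

section \<open>Invariants bounded by the size of a local base\<close>

text \<open>
  Inside each member \<open>V\<close> of a local base, choose a basic neighbourhood of radius \<open>\<delta> V\<close> over a
  closed set \<open>S V\<close>. A neighbourhood given by \<open>B\<close> and \<open>\<epsilon>\<close> contains some \<open>V\<close>, hence the one chosen
  inside \<open>V\<close>, and comparing the two shows that the pairs \<open>(S V, \<delta> V)\<close> are cofinal. The first
  components give a base of the bornology, the reciprocals of the second a dominating family.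
\<close>
lemma local_base_basic_refinement:
  fixes \<B> :: "'a::metric_space set set"
  assumes "bornology \<B>" and "has_closed_base \<B>" and f: "f \<in> cont_funs"
    and \<V>: "local_base (whitney_topology \<B>) f \<V>"
  shows "\<exists>S \<delta>. (\<forall>V\<in>\<V>. S V \<in> \<B>) \<and> (\<forall>V\<in>\<V>. \<delta> V \<in> pos_cont_funs) \<and>
    (\<forall>B\<in>\<B>. \<forall>\<epsilon>\<in>pos_cont_funs. \<exists>V\<in>\<V>. B \<subseteq> S V \<and> (\<forall>x\<in>B. \<delta> V x < 2 * \<epsilon> x))"
proof -
  define inside where "inside V B \<epsilon> \<longleftrightarrow>
      B \<in> \<B> \<and> closed B \<and> \<epsilon> \<in> pos_cont_funs \<and> whitney_basic B \<epsilon> `` {f} \<subseteq> V" for V B \<epsilon>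
  have "\<forall>V\<in>\<V>. \<exists>B \<epsilon>. inside V B \<epsilon>"
  proof
    fix V assume "V \<in> \<V>"
    then have "openin (whitney_topology \<B>) V" "f \<in> V" using \<V> unfolding local_base_def by blast+
    then show "\<exists>B \<epsilon>. inside V B \<epsilon>"
      unfolding inside_def by (rule whitney_open_contains_closed_basic[OF assms(1,2)])
  qed
  then obtain S \<delta> where "\<forall>V\<in>\<V>. inside V (S V) (\<delta> V)" by metis
  then have S: "S V \<in> \<B>" "closed (S V)" "\<delta> V \<in> pos_cont_funs"
      "whitney_basic (S V) (\<delta> V) `` {f} \<subseteq> V" if "V \<in> \<V>" for V
    using that unfolding inside_def by auto
  have cofinal: "\<forall>B\<in>\<B>. \<forall>\<epsilon>\<in>pos_cont_funs.
      \<exists>V\<in>\<V>. B \<subseteq> S V \<and> (\<forall>x\<in>B. \<delta> V x < 2 * \<epsilon> x)"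
  proof (intro ballI)
    fix B and \<epsilon> :: "'a \<Rightarrow> real"
    assume B: "B \<in> \<B>" "\<epsilon> \<in> pos_cont_funs"
    obtain U where U: "openin (whitney_topology \<B>) U" "f \<in> U" "U \<subseteq> whitney_basic B \<epsilon> `` {f}"
      using whitney_basic_contains_open[OF assms(1) B f] by blast
    then obtain V where V: "V \<in> \<V>" "V \<subseteq> U" using \<V> unfolding local_base_def by blast
    have "S V \<noteq> {}" using S(1)[OF V(1)] assms(1) unfolding bornology_def by auto
    moreover have "whitney_basic (S V) (\<delta> V) `` {f} \<subseteq> whitney_basic B \<epsilon> `` {f}"
      using S(4)[OF V(1)] V(2) U(3) by (meson subset_trans)
    ultimately have "B \<subseteq> S V" "\<forall>x\<in>B. \<delta> V x < 2 * \<epsilon> x"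
      using whitney_basic_Image_subsetD[OF f S(3,2)[OF V(1)]] by auto
    then show "\<exists>V\<in>\<V>. B \<subseteq> S V \<and> (\<forall>x\<in>B. \<delta> V x < 2 * \<epsilon> x)" using V(1) by blast
  qed
  moreover have "\<forall>V\<in>\<V>. S V \<in> \<B>" "\<forall>V\<in>\<V>. \<delta> V \<in> pos_cont_funs" using S(1,3) by blast+
  ultimately show ?thesis by (intro exI conjI)
qed

lemma weight_le_local_base:
  fixes \<B> :: "'a::metric_space set set"
  assumes "bornology \<B>" and "has_closed_base \<B>" and "f \<in> cont_funs"
    and "local_base (whitney_topology \<B>) f \<V>"
  shows "min_card {\<B>\<^sub>0. bornology_base \<B> \<B>\<^sub>0} \<le>o |\<V>|"
proof -
  obtain S \<delta> where S: "\<forall>V\<in>\<V>. S V \<in> \<B>" and \<delta>: "\<forall>V\<in>\<V>. \<delta> V \<in> pos_cont_funs"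
    and cofinal: "\<forall>B\<in>\<B>. \<forall>\<epsilon>\<in>pos_cont_funs.
      \<exists>V\<in>\<V>. B \<subseteq> S V \<and> (\<forall>x\<in>B. \<delta> V x < 2 * \<epsilon> x)"
    using local_base_basic_refinement[OF assms] by (elim exE conjE) (rule that)
  have "(\<lambda>_. 1) \<in> (pos_cont_funs :: ('a \<Rightarrow> real) set)" by (simp add: pos_cont_funs_def)
  then have "\<exists>V\<in>\<V>. B \<subseteq> S V" if "B \<in> \<B>" for B
    using cofinal that by fast
  then have "bornology_base \<B> (S ` \<V>)"
    using S unfolding bornology_base_def by auto
  then have "min_card {\<B>\<^sub>0. bornology_base \<B> \<B>\<^sub>0} \<le>o |S ` \<V>|" by (intro min_card_le) simp
  then show ?thesis using card_of_image by (rule ordLeq_transitive)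
qed

lemma domination_le_local_base:
  fixes \<B> :: "'a::metric_space set set"
  assumes "bornology \<B>" and "has_closed_base \<B>" and "f \<in> cont_funs"
    and "local_base (whitney_topology \<B>) f \<V>"
  shows "min_card {F. dominating \<B> F} \<le>o |\<V>|"
proof -
  obtain S \<delta> where S: "\<forall>V\<in>\<V>. S V \<in> \<B>" and \<delta>: "\<forall>V\<in>\<V>. \<delta> V \<in> pos_cont_funs"
    and cofinal: "\<forall>B\<in>\<B>. \<forall>\<epsilon>\<in>pos_cont_funs.
      \<exists>V\<in>\<V>. B \<subseteq> S V \<and> (\<forall>x\<in>B. \<delta> V x < 2 * \<epsilon> x)"
    using local_base_basic_refinement[OF assms] by (elim exE conjE) (rule that)
  \<comment> \<open>The numerator compensates for the factor 2 in \<open>cofinal\<close>.\<close>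
  define G where "G = (\<lambda>V x. 2 / \<delta> V x)"
  have "dominating \<B> (G ` \<V>)"
    unfolding dominating_def
  proof (intro conjI ballI)
    have "continuous_on UNIV (G V)" if "V \<in> \<V>" for V
    proof -
      have "continuous_on UNIV (\<delta> V)" "\<forall>x\<in>UNIV. \<delta> V x \<noteq> 0"
        using \<delta> that by (auto simp: pos_cont_funs_def less_imp_neq[symmetric])
      then show ?thesis unfolding G_def by (intro continuous_intros)
    qed
    then show "G ` \<V> \<subseteq> cont_funs" by (auto simp: cont_funs_def)
  next
    fix u :: "'a \<Rightarrow> real" and B
    assume u: "u \<in> cont_funs" and B: "B \<in> \<B>"
    define \<epsilon> where "\<epsilon> = (\<lambda>x. 1 / max (u x) 1)"
    have "\<forall>x\<in>UNIV. max (u x) 1 \<noteq> 0" by (smt (verit))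
    then have \<epsilon>: "\<epsilon> \<in> pos_cont_funs"
      using u unfolding pos_cont_funs_def cont_funs_def \<epsilon>_def
      by (auto intro!: continuous_intros simp: less_max_iff_disj)
    from bspec[OF bspec[OF cofinal B] \<epsilon>]
    obtain V where V: "V \<in> \<V>" "\<forall>x\<in>B. \<delta> V x < 2 * \<epsilon> x" by blast
    have "u x \<le> G V x" if "x \<in> B" for x
    proof -
      have pos: "0 < \<delta> V x" "0 < max (u x) 1"
        using \<delta> V(1) by (auto simp: pos_cont_funs_def)
      have "\<delta> V x < 2 / max (u x) 1" using V(2) that by (simp add: \<epsilon>_def)
      then have "max (u x) 1 < 2 / \<delta> V x"
        using pos_less_divide_eq[OF pos(1)] pos_less_divide_eq[OF pos(2)]
        by (metis mult.commute)
      then show ?thesis by (simp add: G_def)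
    qed
    then show "\<exists>g\<in>G ` \<V>. \<forall>x\<in>B. u x \<le> g x" using V(1) by (intro bexI[of _ "G V"]) auto
  qed
  then have "min_card {F. dominating \<B> F} \<le>o |G ` \<V>|" by (intro min_card_le) simp
  then show ?thesis using card_of_image by (rule ordLeq_transitive)
qed

section \<open>A local base from a dominating family and a base\<close>

lemma local_base_from_dominating:
  fixes \<B> :: "'a::topological_space set set"
  assumes "bornology \<B>" and F: "dominating \<B> F" and \<B>\<^sub>0: "bornology_base \<B> \<B>\<^sub>0"
    and f: "f \<in> cont_funs"
  shows "\<exists>\<V>. local_base (whitney_topology \<B>) f \<V> \<and> |\<V>| \<le>o |F \<times> \<B>\<^sub>0|"
proof -
  \<comment> \<open>A dominating function may vanish or be negative; truncating it at 1 makes its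
    reciprocal a radius and preserves domination.\<close>
  define r :: "('a \<Rightarrow> real) \<Rightarrow> 'a \<Rightarrow> real" where "r = (\<lambda>g x. 1 / max (g x) 1)"
  have r: "r g \<in> pos_cont_funs" if "g \<in> F" for g
  proof -
    have "continuous_on UNIV g" using F that unfolding dominating_def cont_funs_def by blast
    moreover have "\<forall>x\<in>UNIV. max (g x) 1 \<noteq> 0" by (smt (verit))
    ultimately show ?thesis
      unfolding pos_cont_funs_def r_def
      by (auto intro!: continuous_intros simp: less_max_iff_disj)
  qed
  define inside where "inside p U \<longleftrightarrow> openin (whitney_topology \<B>) U \<and> f \<in> U \<and>
      U \<subseteq> whitney_basic (snd p) (r (fst p)) `` {f}" for p U
  have "\<forall>p\<in>F \<times> \<B>\<^sub>0. \<exists>U. inside p U"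
  proof
    fix p assume "p \<in> F \<times> \<B>\<^sub>0"
    then have "snd p \<in> \<B>" "r (fst p) \<in> pos_cont_funs"
      using r \<B>\<^sub>0 unfolding bornology_base_def by auto
    then show "\<exists>U. inside p U"
      unfolding inside_def by (rule whitney_basic_contains_open[OF assms(1) _ _ f])
  qed
  then obtain N where "\<forall>p\<in>F \<times> \<B>\<^sub>0. inside p (N p)" by metis
  then have N: "openin (whitney_topology \<B>) (N p)" "f \<in> N p"
      "N p \<subseteq> whitney_basic (snd p) (r (fst p)) `` {f}" if "p \<in> F \<times> \<B>\<^sub>0" for p
    using that unfolding inside_def by blast+
  have "\<exists>V\<in>N ` (F \<times> \<B>\<^sub>0). V \<subseteq> U" if U: "openin (whitney_topology \<B>) U" "f \<in> U" for U
  proof -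
    obtain B \<epsilon> where B: "B \<in> \<B>" "\<epsilon> \<in> pos_cont_funs" "whitney_basic B \<epsilon> `` {f} \<subseteq> U"
      using whitney_open_contains_basic[OF assms(1) U] by blast
    have pos: "0 < \<epsilon> x" for x using B(2) by (simp add: pos_cont_funs_def)
    then have "\<forall>x\<in>UNIV. \<epsilon> x \<noteq> 0" by (metis less_irrefl)
    then have inv: "(\<lambda>x. 1 / \<epsilon> x) \<in> cont_funs"
      using B(2) unfolding cont_funs_def pos_cont_funs_def by (auto intro!: continuous_intros)
    have "\<forall>u\<in>cont_funs. \<forall>B\<in>\<B>. \<exists>g\<in>F. \<forall>x\<in>B. u x \<le> g x"
      using F by (simp add: dominating_def)
    from bspec[OF bspec[OF this inv] B(1)]
    obtain g where g: "g \<in> F" "\<forall>x\<in>B. 1 / \<epsilon> x \<le> g x" by blast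
    obtain C where C: "C \<in> \<B>\<^sub>0" "B \<subseteq> C" using \<B>\<^sub>0 B(1) unfolding bornology_base_def by blast
    have le: "r g x \<le> \<epsilon> x" if "x \<in> B" for x
    proof -
      have "1 / \<epsilon> x \<le> max (g x) 1" using g(2) that by (simp add: le_max_iff_disj)
      then show ?thesis using pos[of x] by (simp add: r_def field_simps)
    qed
    have "whitney_basic C (r g) `` {f} \<subseteq> whitney_basic B \<epsilon> `` {f}"
      using C(2) le by (fastforce simp: whitney_basic_iff)
    moreover have "N (g, C) \<subseteq> whitney_basic C (r g) `` {f}" using N(3)[of "(g, C)"] g(1) C(1) by simp
    ultimately have "N (g, C) \<subseteq> U" using B(3) by (meson subset_trans)
    then show ?thesis using g(1) C(1) by (intro bexI[of _ "N (g, C)"]) auto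
  qed
  then have "local_base (whitney_topology \<B>) f (N ` (F \<times> \<B>\<^sub>0))"
    using N(1,2) unfolding local_base_def by (auto simp del: mem_Sigma_iff)
  then show ?thesis using card_of_image by blast
qed

section \<open>The character\<close>

lemma Card_order_min_card:
  assumes "F \<noteq> {}"
  shows "Card_order (min_card F)"
  using min_card_attained[OF assms] card_of_Card_order by metis

lemma natLeq_csum_bound:
  assumes "Card_order r" and "Card_order s" and "natLeq \<le>o s" and "r \<le>o s"
  shows "natLeq +c r \<le>o s"
proof -
  have "Cinfinite s" using cinfinite_mono[OF assms(3)] natLeq_cinfinite assms(2) by simp
  then show ?thesis by (rule csum_cinfinite_bound[OF assms(3,4) natLeq_Card_order assms(1)])
qed

theorem theorem3p13:
  fixes \<B> :: "'a::metric_space set set"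
  assumes "\<exists>x y :: 'a. x \<noteq> y"
    and "bornology \<B>"
    and "has_closed_base \<B>"
  shows "character (whitney_topology \<B>) =o domination_number \<B> *c bornology_weight \<B>"
proof -
  let ?Y = "whitney_topology \<B>"
  let ?d = "min_card {F. dominating \<B> F}"
  let ?w = "min_card {\<B>\<^sub>0. bornology_base \<B> \<B>\<^sub>0}"
  let ?P = "domination_number \<B> *c bornology_weight \<B>"
  note top = topspace_whitney_topology[OF assms(2)]
  have "dominating \<B> cont_funs" unfolding dominating_def by blast
  then have neD: "{F. dominating \<B> F} \<noteq> {}" by blast
  have "bornology_base \<B> \<B>" unfolding bornology_base_def by blast
  then have neW: "{\<B>\<^sub>0. bornology_base \<B> \<B>\<^sub>0} \<noteq> {}" by blast
  have "local_base ?Y f {V. openin ?Y V \<and> f \<in> V}" for f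
    unfolding local_base_def by blast
  then have neL: "{\<V>. local_base ?Y f \<V>} \<noteq> {}" for f by blast
  note co = Card_order_min_card[OF neD] Card_order_min_card[OF neW] Card_order_min_card[OF neL]
  have coDW: "Card_order (domination_number \<B>)" "Card_order (bornology_weight \<B>)"
    unfolding domination_number_def bornology_weight_def by (rule Card_order_csum)+
  have coA: "\<forall>r\<in>character_at ?Y ` topspace ?Y. Card_order r"
    unfolding character_at_def by (auto intro: Card_order_csum)
  have "cinfinite (domination_number \<B>)"
    unfolding domination_number_def by (rule cinfinite_csum) (simp add: natLeq_Cinfinite)
  then have nzD: "Cnotzero (domination_number \<B>)"
    using coDW(1) by (intro Cinfinite_Cnotzero) simp
  have coP: "Card_order ?P" by (rule Card_order_cprod)

  have "character_at ?Y f \<le>o ?P" if f: "f \<in> cont_funs" for f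
  proof -
    obtain F where F: "dominating \<B> F" "?d = |F|" using min_card_attained[OF neD] by blast
    obtain W where W: "bornology_base \<B> W" "?w = |W|" using min_card_attained[OF neW] by blast
    obtain \<V> where \<V>: "local_base ?Y f \<V>" "|\<V>| \<le>o |F \<times> W|"
      using local_base_from_dominating[OF assms(2) F(1) W(1) f] by blast
    have "min_card {\<V>. local_base ?Y f \<V>} \<le>o |\<V>|" using \<V>(1) by (intro min_card_le) simp
    also have "|\<V>| \<le>o |F \<times> W|" by (rule \<V>(2))
    also have "|F \<times> W| = ?d *c ?w" by (simp add: cprod_def F(2) W(2) Field_card_of)
    also have "?d *c ?w \<le>o ?P"
      unfolding domination_number_def bornology_weight_def
      by (intro cprod_mono ordLeq_csum2 co(1,2))
    finally have "min_card {\<V>. local_base ?Y f \<V>} \<le>o ?P" .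
    moreover have "natLeq \<le>o ?P"
    proof -
      have "natLeq \<le>o bornology_weight \<B>"
        unfolding bornology_weight_def by (rule ordLeq_csum1[OF natLeq_Card_order])
      also have "bornology_weight \<B> \<le>o ?P" by (rule ordLeq_cprod2[OF nzD coDW(2)])
      finally show ?thesis .
    qed
    ultimately show ?thesis
      unfolding character_at_def by (intro natLeq_csum_bound[OF co(3) coP])
  qed
  \<comment> \<open>The least-upper-bound property of \<open>card_sup\<close> refers to cardinalities of sets, so the
    product is replaced by its field.\<close>
  then have "\<forall>r\<in>character_at ?Y ` topspace ?Y. r \<le>o |Field ?P|"
    using top card_of_Field_ordIso[OF coP] ordIso_symmetric ordLeq_ordIso_trans by blast
  then have "character ?Y \<le>o |Field ?P|"
    unfolding character_def by (rule card_sup_least[OF coA])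
  then have upper: "character ?Y \<le>o ?P"
    using card_of_Field_ordIso[OF coP] ordLeq_ordIso_trans by blast

  \<comment> \<open>The lower bound already holds for the character at a single point.\<close>
  define f :: "'a \<Rightarrow> real" where "f = (\<lambda>_. 0)"
  have f: "f \<in> cont_funs" by (simp add: f_def cont_funs_def)
  obtain \<V> where \<V>: "local_base ?Y f \<V>" "min_card {\<V>. local_base ?Y f \<V>} = |\<V>|"
    using min_card_attained[OF neL] by blast
  define c where "c = character_at ?Y f"
  have coc: "Card_order c" unfolding c_def character_at_def by (rule Card_order_csum)
  have c: "natLeq \<le>o c" "|\<V>| \<le>o c"
    unfolding c_def character_at_def \<V>(2)
    by (rule ordLeq_csum1[OF natLeq_Card_order], rule ordLeq_csum2[OF card_of_Card_order])
  have "?d \<le>o c"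
    using domination_le_local_base[OF assms(2,3) f \<V>(1)] c(2) by (rule ordLeq_transitive)
  then have D: "domination_number \<B> \<le>o c"
    unfolding domination_number_def by (rule natLeq_csum_bound[OF co(1) coc c(1)])
  have "?w \<le>o c"
    using weight_le_local_base[OF assms(2,3) f \<V>(1)] c(2) by (rule ordLeq_transitive)
  then have W: "bornology_weight \<B> \<le>o c"
    unfolding bornology_weight_def by (rule natLeq_csum_bound[OF co(2) coc c(1)])
  have "Cinfinite c" using cinfinite_mono[OF c(1) natLeq_cinfinite] coc by simp
  then have "?P \<le>o c" by (rule cprod_cinfinite_bound[OF D W coDW])
  also have "c \<le>o character ?Y"
    unfolding character_def c_def using card_sup_upper[OF coA] f top by blast
  finally show ?thesis using upper ordIso_iff_ordLeq by blast
qed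

end
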